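(* For every $n\ge 2$ let $f_n: D_n\to D_{n-1}$ be the map sending a Dyck path $P$ of size $n$ to the Dyck path of size $n-1$ obtained by deleting the first peak $UD$ of $P$, where $D_n$ carries the ascent order. Then $f_n$ is an epimorphism of posets and an epimorphism of graphs between the Hasse diagrams of $D_n$ and $D_{n-1}$, and $f_n$ is monotone. Consequently the inverse limit $D=\varprojlim(D_n,f_n)$, as a topological graph, is Kelley.
   Context: **Dyck paths and the ascent order.** A Dyck path is a lattice path starting at $(0,0)$ with up steps $U=(1,1)$ and down steps $D=(1,-1)$, ending on the $x$-axis and never going strictly below it; its size is its number of up steps. $D_n$ denotes the set of Dyck paths of size $n$. A factor is a nonempty sequence of consecutive steps; a peak is a factor $UD$. The ascent order on $D_n$ is the partial order whose cover relations are: $Q$ covers $P$ if there is in $P$ a factor $DU^kD$ (with $k\ge 1$) such that $Q$ is obtained from $P$ by replacing this factor by $U^kDD$. An epimorphism of posets is an order-preserving surjection. **Graphs.** A graph $A=(V(A),E(A))$ has $E(A)\subseteq V(A)^2$ reflexive and symmetric, so every vertex carries a loop. The Hasse diagram of a finite poset is regarded as such a graph: two distinct elements are joined by an edge if and only if one covers the other, and every element carries a loop. A homomorphism of graphs is a map on vertices sending edges to edges; an epimorphism is a homomorphism that is surjective on vertices and on edges. A topological graph is a graph $K$ whose vertex set is a $0$-dimensional, compact, second-countable space and whose edge set is a closed, reflexive, symmetric subset of $V(K)^2$; finite graphs carry the discrete topology. **Connectedness and monotone maps.** A subset $S$ of the vertex set of a topological graph (with the induced edges and topology) is disconnected if it is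 the union of two disjoint nonempty relatively closed subsets with no edge joining them; otherwise it is connected. An epimorphism is monotone if preimages of closed connected sets are connected. **Inverse limit.** $\varprojlim(D_n,f_n)$ is the subspace of $\prod_{n\ge 1} D_n$ of sequences $(x_n)$ with $x_{n-1}=f_n(x_n)$ for all $n\ge2$; $\langle (a_n),(b_n)\rangle$ is an edge if and only if $\langle a_n,b_n\rangle$ is an edge of $D_n$ for every $n$. **Kelley.** A topological graph $X$ is Kelley if it is connected and, for every closed connected $K\subseteq X$, every vertex $p\in K$ and every sequence $p_n\to p$ of vertices of $X$, there are closed connected sets $K_n\subseteq X$ with $p_n\in K_n$ and $K_n\to K$ in the Hausdorff metric. *)

theory Defs
  imports "HOL-Analysis.Analysis"
begin

section \<open>Dyck paths and the ascent order\<close>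

datatype step = Up | Down

type_synonym path = "step list"

definition height :: "path \<Rightarrow> int" where
  "height P = int (count_list P Up) - int (count_list P Down)"

definition dyck :: "nat \<Rightarrow> path set" where
  "dyck n = {P. (\<forall>i. 0 \<le> height (take i P)) \<and> height P = 0 \<and> count_list P Up = n}"

definition ascent_cover :: "nat \<Rightarrow> path rel" where
  "ascent_cover n = {(P, Q). P \<in> dyck n \<and> Q \<in> dyck n \<and>
     (\<exists>A B k. k \<ge> 1 \<and>
        P = A @ [Down] @ replicate k Up @ [Down] @ B \<and>
        Q = A @ replicate k Up @ [Down, Down] @ B)}"

text \<open>The restriction only removes the pairs \<^term>\<open>(P, P)\<close> with \<^term>\<open>P\<close> outside \<^term>\<open>dyck n\<close>.
  That the covering pairs of this order are exactly those in \<^const>\<open>ascent_cover\<close> is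
  proved below.\<close>

definition ascent_order :: "nat \<Rightarrow> path rel" where
  "ascent_order n = (ascent_cover n)\<^sup>* \<inter> (dyck n \<times> dyck n)"

fun delete_first_peak :: "path \<Rightarrow> path" where
  "delete_first_peak [] = []"
| "delete_first_peak (Up # Down # P) = P"
| "delete_first_peak (s # P) = s # delete_first_peak P"

section \<open>Posets and their Hasse diagrams\<close>

definition covers :: "'a rel \<Rightarrow> 'a \<Rightarrow> 'a \<Rightarrow> bool" where
  "covers r y x \<longleftrightarrow> (x, y) \<in> r \<and> x \<noteq> y \<and>
     (\<forall>z. (x, z) \<in> r \<and> (z, y) \<in> r \<longrightarrow> z = x \<or> z = y)"

definition hasse_edges :: "'a set \<Rightarrow> 'a rel \<Rightarrow> ('a \<times> 'a) set" where
  "hasse_edges V r =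
     {(x, y). x \<in> V \<and> y \<in> V \<and> (x = y \<or> covers r x y \<or> covers r y x)}"

definition poset_epi :: "'a set \<Rightarrow> 'a rel \<Rightarrow> 'b set \<Rightarrow> 'b rel \<Rightarrow> ('a \<Rightarrow> 'b) \<Rightarrow> bool" where
  "poset_epi V r W s f \<longleftrightarrow>
     partial_order_on V r \<and> partial_order_on W s \<and>
     f ` V = W \<and> (\<forall>x y. (x, y) \<in> r \<longrightarrow> (f x, f y) \<in> s)"

section \<open>Graphs and topological graphs\<close>

definition is_graph :: "'a set \<Rightarrow> ('a \<times> 'a) set \<Rightarrow> bool" where
  "is_graph V E \<longleftrightarrow> E \<subseteq> V \<times> V \<and> refl_on V E \<and> sym E"

definition graph_hom ::
  "'a set \<Rightarrow> ('a \<times> 'a) set \<Rightarrow> 'b set \<Rightarrow> ('b \<times> 'b) set \<Rightarrow> ('a \<Rightarrow> 'b) \<Rightarrow> bool" where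
  "graph_hom V E W F f \<longleftrightarrow>
     is_graph V E \<and> is_graph W F \<and> f \<in> V \<rightarrow> W \<and>
     (\<forall>x y. (x, y) \<in> E \<longrightarrow> (f x, f y) \<in> F)"

definition graph_epi ::
  "'a set \<Rightarrow> ('a \<times> 'a) set \<Rightarrow> 'b set \<Rightarrow> ('b \<times> 'b) set \<Rightarrow> ('a \<Rightarrow> 'b) \<Rightarrow> bool" where
  "graph_epi V E W F f \<longleftrightarrow>
     graph_hom V E W F f \<and> f ` V = W \<and> map_prod f f ` E = F"

definition second_countable_space :: "'a topology \<Rightarrow> bool" where
  "second_countable_space X \<longleftrightarrow>
     (\<exists>\<B>. countable \<B> \<and> (\<forall>V \<in> \<B>. openin X V) \<and>
        (\<forall>U x. openin X U \<and> x \<in> U \<longrightarrow> (\<exists>V \<in> \<B>. x \<in> V \<and> V \<subseteq> U)))"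

text \<open>The Hausdorff axiom is part of the usual convention for 0-dimensional compact
  second-countable spaces; it makes the space metrizable, so that the Hausdorff metric is
  available.\<close>

definition topological_graph :: "'a topology \<Rightarrow> ('a \<times> 'a) set \<Rightarrow> bool" where
  "topological_graph X E \<longleftrightarrow>
     X dim_le 0 \<and> compact_space X \<and> Hausdorff_space X \<and> second_countable_space X \<and>
     is_graph (topspace X) E \<and> closedin (prod_topology X X) E"

definition graph_disconnected :: "'a topology \<Rightarrow> ('a \<times> 'a) set \<Rightarrow> 'a set \<Rightarrow> bool" where
  "graph_disconnected X E S \<longleftrightarrow>
     (\<exists>A B. S = A \<union> B \<and> A \<inter> B = {} \<and> A \<noteq> {} \<and> B \<noteq> {} \<and>
        closedin (subtopology X S) A \<and> closedin (subtopology X S) B \<and>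
        \<not> (\<exists>a \<in> A. \<exists>b \<in> B. (a, b) \<in> E \<or> (b, a) \<in> E))"

definition graph_connected :: "'a topology \<Rightarrow> ('a \<times> 'a) set \<Rightarrow> 'a set \<Rightarrow> bool" where
  "graph_connected X E S \<longleftrightarrow> S \<subseteq> topspace X \<and> \<not> graph_disconnected X E S"

definition monotone_epi ::
  "'a topology \<Rightarrow> ('a \<times> 'a) set \<Rightarrow> 'b topology \<Rightarrow> ('b \<times> 'b) set \<Rightarrow> ('a \<Rightarrow> 'b) \<Rightarrow> bool" where
  "monotone_epi X E Y F f \<longleftrightarrow>
     graph_epi (topspace X) E (topspace Y) F f \<and>
     (\<forall>S. closedin Y S \<and> graph_connected Y F S \<longrightarrow>
        graph_connected X E {x \<in> topspace X. f x \<in> S})"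

section \<open>Inverse limits\<close>

text \<open>Sequences are indexed by \<^term>\<open>{1..} :: nat set\<close>; the bonding map \<^term>\<open>f n\<close> goes from
  level \<^term>\<open>n\<close> to level \<^term>\<open>n - 1\<close>, for \<^term>\<open>n \<ge> (2::nat)\<close>.\<close>

definition inv_limit_verts :: "(nat \<Rightarrow> 'a set) \<Rightarrow> (nat \<Rightarrow> 'a \<Rightarrow> 'a) \<Rightarrow> (nat \<Rightarrow> 'a) set" where
  "inv_limit_verts V f = {x \<in> PiE {1..} V. \<forall>n\<ge>2. x (n - 1) = f n (x n)}"

definition inv_limit_topology ::
  "(nat \<Rightarrow> 'a set) \<Rightarrow> (nat \<Rightarrow> 'a \<Rightarrow> 'a) \<Rightarrow> (nat \<Rightarrow> 'a) topology" where
  "inv_limit_topology V f =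
     subtopology (product_topology (\<lambda>n. discrete_topology (V n)) {1..}) (inv_limit_verts V f)"

definition inv_limit_edges ::
  "(nat \<Rightarrow> 'a set) \<Rightarrow> (nat \<Rightarrow> ('a \<times> 'a) set) \<Rightarrow> (nat \<Rightarrow> 'a \<Rightarrow> 'a) \<Rightarrow>
     ((nat \<Rightarrow> 'a) \<times> (nat \<Rightarrow> 'a)) set" where
  "inv_limit_edges V E f =
     {(a, b). a \<in> inv_limit_verts V f \<and> b \<in> inv_limit_verts V f \<and> (\<forall>n\<ge>1. (a n, b n) \<in> E n)}"

section \<open>Kelley topological graphs\<close>

text \<open>The Hausdorff metric of \<^term>\<open>d\<close>; used only for nonempty closed subsets of a compact
  space, where the suprema and infima are those of nonempty bounded sets.\<close>

definition hausdorff_metric :: "('a \<Rightarrow> 'a \<Rightarrow> real) \<Rightarrow> 'a set \<Rightarrow> 'a set \<Rightarrow> real" where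
  "hausdorff_metric d A B =
     max (SUP a\<in>A. INF b\<in>B. d a b) (SUP b\<in>B. INF a\<in>A. d a b)"

text \<open>A topological graph carries no distinguished metric, so \<^term>\<open>d\<close> ranges over all metrics
  inducing its topology. Such metrics exist, and by compactness they all give the same notion
  of Hausdorff convergence.\<close>

definition kelley :: "'a topology \<Rightarrow> ('a \<times> 'a) set \<Rightarrow> bool" where
  "kelley X E \<longleftrightarrow>
     topological_graph X E \<and> graph_connected X E (topspace X) \<and>
     (\<forall>d. Metric_space (topspace X) d \<and> Metric_space.mtopology (topspace X) d = X \<longrightarrow>
       (\<forall>K p ps.
          closedin X K \<and> graph_connected X E K \<and> p \<in> K \<and>
          (\<forall>n. ps n \<in> topspace X) \<and> limitin X ps p sequentially \<longrightarrow>
          (\<exists>Ks :: nat \<Rightarrow> 'a set.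
             (\<forall>n. closedin X (Ks n) \<and> graph_connected X E (Ks n) \<and> ps n \<in> Ks n) \<and>
             (\<lambda>n. hausdorff_metric d (Ks n) K) \<longlonglongrightarrow> 0)))"

section \<open>The covering pairs of the ascent order\<close>

text \<open>For each down step, the number of up steps preceding it (shifted by \<^term>\<open>c\<close>). An ascent
  cover changes exactly one entry of this list, raising it to the next entry.\<close>

fun ups_before :: "nat \<Rightarrow> path \<Rightarrow> nat list" where
  "ups_before c [] = []"
| "ups_before c (Up # P) = ups_before (Suc c) P"
| "ups_before c (Down # P) = c # ups_before c P"

lemma ups_before_append:
  "ups_before c (P @ Q) = ups_before c P @ ups_before (c + count_list P Up) Q"
  by (induction c P rule: ups_before.induct) auto

lemma ups_before_replicate: "ups_before c (replicate k Up) = []"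
  by (induction k arbitrary: c) auto

lemma count_list_replicate_Up: "count_list (replicate k Up) Up = k"
  by (induction k) auto

lemma ups_before_ge: "x \<in> set (ups_before c P) \<Longrightarrow> c \<le> x"
  by (induction c P rule: ups_before.induct) auto

lemma ups_before_inject:
  "ups_before c P = ups_before c Q \<Longrightarrow> count_list P Up = count_list Q Up \<Longrightarrow> P = Q"
proof (induction c P arbitrary: Q rule: ups_before.induct)
  case (1 c)
  then show ?case
    by (cases "(c, Q)" rule: ups_before.cases) auto
next
  case (2 c P)
  show ?case
  proof (cases "(c, Q)" rule: ups_before.cases)
    case (3 c' Q')
    then have "c \<in> set (ups_before (Suc c) P)"
      using 2 by auto
    then show ?thesis
      using ups_before_ge by fastforce
  qed (use 2 in auto)
next
  case (3 c P)
  show ?case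
  proof (cases "(c, Q)" rule: ups_before.cases)
    case (2 c' Q')
    then have "c \<in> set (ups_before (Suc c) Q')"
      using 3 by (metis Pair_inject list.set_intros(1) ups_before.simps(2,3))
    then show ?thesis
      using ups_before_ge by fastforce
  qed (use 3 in auto)
qed

lemma ascent_cover_ups_before:
  assumes "(P, Q) \<in> ascent_cover n"
  obtains i where "Suc i < length (ups_before 0 P)"
    "ups_before 0 P ! i < ups_before 0 P ! Suc i"
    "ups_before 0 Q = (ups_before 0 P)[i := ups_before 0 P ! Suc i]"
proof -
  obtain A B k where k: "k \<ge> 1" and
    P: "P = A @ [Down] @ replicate k Up @ [Down] @ B" and
    Q: "Q = A @ replicate k Up @ [Down, Down] @ B"
    using assms by (auto simp: ascent_cover_def)
  show thesis
    by (rule that[of "length (ups_before 0 A)"])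
      (use k in \<open>auto simp: P Q ups_before_append ups_before_replicate count_list_replicate_Up nth_append\<close>)
qed

lemma ascent_rtrancl_mono:
  assumes "(P, Q) \<in> (ascent_cover n)\<^sup>*"
  shows "length (ups_before 0 P) = length (ups_before 0 Q)"
    and "i < length (ups_before 0 P) \<Longrightarrow> ups_before 0 P ! i \<le> ups_before 0 Q ! i"
proof -
  have "length (ups_before 0 P) = length (ups_before 0 Q) \<and>
      (\<forall>i < length (ups_before 0 P). ups_before 0 P ! i \<le> ups_before 0 Q ! i)"
    using assms
  proof (induction rule: rtrancl_induct)
    case (step Q R)
    from step(2) obtain j where "Suc j < length (ups_before 0 Q)"
      "ups_before 0 Q ! j < ups_before 0 Q ! Suc j"
      "ups_before 0 R = (ups_before 0 Q)[j := ups_before 0 Q ! Suc j]"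
      by (rule ascent_cover_ups_before)
    then show ?case
      using step.IH by (fastforce simp: nth_list_update)
  qed simp
  then show "length (ups_before 0 P) = length (ups_before 0 Q)"
    and "i < length (ups_before 0 P) \<Longrightarrow> ups_before 0 P ! i \<le> ups_before 0 Q ! i"
    by auto
qed

lemma dyck_ups_before_inject:
  "P \<in> dyck n \<Longrightarrow> Q \<in> dyck n \<Longrightarrow> ups_before 0 P = ups_before 0 Q \<Longrightarrow> P = Q"
  by (rule ups_before_inject[of 0]) (auto simp: dyck_def)

lemma partial_order_ascent_order: "partial_order_on (dyck n) (ascent_order n)"
proof -
  have "P = Q" if "(P, Q) \<in> ascent_order n" "(Q, P) \<in> ascent_order n" for P Q
  proof (rule dyck_ups_before_inject)
    show "P \<in> dyck n" "Q \<in> dyck n"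
      using that by (auto simp: ascent_order_def)
    show "ups_before 0 P = ups_before 0 Q"
      using that ascent_rtrancl_mono[of P Q n] ascent_rtrancl_mono[of Q P n]
      by (intro nth_equalityI) (auto simp: ascent_order_def intro!: le_antisym)
  qed
  moreover have "trans (ascent_order n)"
    unfolding ascent_order_def by (intro transI) (auto intro: rtrancl_trans)
  ultimately show ?thesis
    by (auto simp: partial_order_on_def preorder_on_def refl_on_def antisym_def ascent_order_def)
qed

lemma ascent_cover_eq_of_between:
  assumes PQ: "(P, Q) \<in> ascent_cover n" and PR: "(P, R) \<in> ascent_cover n"
    and RQ: "(R, Q) \<in> (ascent_cover n)\<^sup>*"
  shows "R = Q"
proof -
  obtain i where i: "Suc i < length (ups_before 0 P)"
    "ups_before 0 P ! i < ups_before 0 P ! Suc i"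
    "ups_before 0 Q = (ups_before 0 P)[i := ups_before 0 P ! Suc i]"
    by (rule ascent_cover_ups_before[OF PQ])
  obtain j where j: "Suc j < length (ups_before 0 P)"
    "ups_before 0 P ! j < ups_before 0 P ! Suc j"
    "ups_before 0 R = (ups_before 0 P)[j := ups_before 0 P ! Suc j]"
    by (rule ascent_cover_ups_before[OF PR])
  have "ups_before 0 R ! j \<le> ups_before 0 Q ! j"
    using ascent_rtrancl_mono(2)[OF RQ, of j] j by simp
  then have "i = j"
    using i j by (auto simp: nth_list_update split: if_splits)
  then have "ups_before 0 R = ups_before 0 Q"
    using i j by simp
  then show ?thesis
    using PQ PR by (intro dyck_ups_before_inject) (auto simp: ascent_cover_def)
qed

lemma ascent_cover_in_order: "(P, Q) \<in> ascent_cover n \<Longrightarrow> (P, Q) \<in> ascent_order n"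
  by (auto simp: ascent_order_def ascent_cover_def)

lemma ascent_cover_neq: "(P, Q) \<in> ascent_cover n \<Longrightarrow> P \<noteq> Q"
  by (erule ascent_cover_ups_before) (metis Suc_lessD less_irrefl nth_list_update_eq)

lemma covers_ascent_order_iff: "covers (ascent_order n) Q P \<longleftrightarrow> (P, Q) \<in> ascent_cover n"
proof
  assume cov: "covers (ascent_order n) Q P"
  then have "(P, Q) \<in> (ascent_cover n)\<^sup>*" "P \<noteq> Q" and Q: "Q \<in> dyck n"
    by (auto simp: covers_def ascent_order_def)
  then obtain R where PR: "(P, R) \<in> ascent_cover n" and RQ: "(R, Q) \<in> (ascent_cover n)\<^sup>*"
    by (meson converse_rtranclE)
  then have "(R, Q) \<in> ascent_order n"
    using Q by (auto simp: ascent_order_def ascent_cover_def)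
  then have "R = Q"
    using cov PR ascent_cover_in_order ascent_cover_neq unfolding covers_def by blast
  then show "(P, Q) \<in> ascent_cover n"
    using PR by simp
next
  assume PQ: "(P, Q) \<in> ascent_cover n"
  have "R = Q" if R: "(P, R) \<in> ascent_order n" "(R, Q) \<in> ascent_order n" "R \<noteq> P" for R
  proof -
    obtain S where S: "(P, S) \<in> ascent_cover n" "(S, R) \<in> (ascent_cover n)\<^sup>*"
      using R by (metis IntD1 ascent_order_def converse_rtranclE)
    have "(S, Q) \<in> (ascent_cover n)\<^sup>*"
      using S R by (auto simp: ascent_order_def)
    then have "S = Q"
      using ascent_cover_eq_of_between PQ S by blast
    then have "(Q, R) \<in> ascent_order n"
      using S R by (auto simp: ascent_order_def)
    then show ?thesis
      using R partial_order_onD(3)[OF partial_order_ascent_order[of n]] by (auto dest: antisymD)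
  qed
  then show "covers (ascent_order n) Q P"
    using PQ ascent_cover_in_order ascent_cover_neq unfolding covers_def by blast
qed

end

theory Submission
  imports Defs
begin

text \<open>
  Write a Dyck path of positive size as \<open>U\<^sup>a U D R\<close>, so that deleting the first peak leaves
  \<open>U\<^sup>a R\<close>. A cover \<open>D U\<^sup>k D \<rightarrow> U\<^sup>k D D\<close> either moves the down step of the first peak, and then
  is collapsed to a point, or takes place after the first peak, and then is still a cover once
  the peak is gone (\<open>delete_first_peak_cover\<close>). Hence the map preserves the order and the edges
  of the Hasse diagram. Putting \<open>U D\<close> in front of a path is a section of the map that also lifts
  covers, which gives surjectivity on vertices and on edges.

  The fibre over \<open>U\<^sup>c D S\<close> consists of the paths \<open>U\<^sup>a U D U\<^sup>j D S\<close> with \<open>a + j = c\<close>. The one with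
  \<open>j = 0\<close> covers all the others, since a single ascent cover moves a down step across the whole
  run of up steps after it. So every fibre is a star, in particular connected
  (\<open>dyck_fibre_star\<close>), and an epimorphism of discrete graphs with connected fibres is monotone
  (\<open>monotone_epi_of_connected_fibres\<close>).

  The Kelley property holds for the limit of any inverse sequence of finite graphs with monotone
  bonding maps and connected first term. By compactness the projections \<open>\<pi>\<^sub>m\<close> of the limit are
  again monotone (\<open>projection_monotone\<close>). Given \<open>K\<close>, \<open>p \<in> K\<close> and \<open>p\<^sub>n \<rightarrow> p\<close>, the set
  \<open>\<pi>\<^sub>m\<^sup>-\<^sup>1 (\<pi>\<^sub>m K)\<close> is therefore clopen and connected; it contains \<open>p\<^sub>n\<close> as soon as \<open>p\<^sub>n\<close> and \<open>p\<close>
  agree at level \<open>m\<close>, and it is close to \<open>K\<close> when \<open>m\<close> is large because cylinders are uniformly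
  small. Taking for \<open>m\<close> the largest level up to \<open>n\<close> at which \<open>p\<^sub>n\<close> and \<open>p\<close> agree gives the sets
  \<open>K\<^sub>n\<close>.
\<close>

section \<open>Connected fibres\<close>

lemma graph_disconnected_discrete:
  assumes "S \<subseteq> V"
  shows "graph_disconnected (discrete_topology V) E S \<longleftrightarrow>
    (\<exists>A B. S = A \<union> B \<and> A \<inter> B = {} \<and> A \<noteq> {} \<and> B \<noteq> {} \<and>
       \<not> (\<exists>a\<in>A. \<exists>b\<in>B. (a, b) \<in> E \<or> (b, a) \<in> E))"
proof -
  have "closedin (subtopology (discrete_topology V) S) A \<longleftrightarrow> A \<subseteq> S" for A
    using assms by (simp add: Int_absorb1)
  then show ?thesis
    unfolding graph_disconnected_def by (intro iff_exI) blast
qed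

lemma graph_connected_star:
  assumes "S \<subseteq> topspace X" "c \<in> S" "\<And>x. x \<in> S \<Longrightarrow> (x, c) \<in> E"
  shows "graph_connected X E S"
  unfolding graph_connected_def graph_disconnected_def using assms by blast

lemma graph_connected_image:
  assumes S: "graph_connected X E S"
    and cont: "continuous_map X Y f"
    and hom: "\<And>x y. x \<in> S \<Longrightarrow> y \<in> S \<Longrightarrow> (x, y) \<in> E \<Longrightarrow> (f x, f y) \<in> F"
  shows "graph_connected Y F (f ` S)"
proof -
  have SX: "S \<subseteq> topspace X"
    using S by (simp add: graph_connected_def)
  have "graph_disconnected X E S" if dis: "graph_disconnected Y F (f ` S)"
  proof -
    obtain A B where AB: "f ` S = A \<union> B" "A \<inter> B = {}" "A \<noteq> {}" "B \<noteq> {}"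
      and cl: "closedin (subtopology Y (f ` S)) A" "closedin (subtopology Y (f ` S)) B"
      and no: "\<not> (\<exists>a\<in>A. \<exists>b\<in>B. (a, b) \<in> F \<or> (b, a) \<in> F)"
      using dis unfolding graph_disconnected_def by blast
    have cS: "continuous_map (subtopology X S) (subtopology Y (f ` S)) f"
      using cont by (simp add: continuous_map_in_subtopology continuous_map_from_subtopology
          image_subset_iff)
    have clS: "closedin (subtopology X S) {x \<in> S. f x \<in> C}"
      if "closedin (subtopology Y (f ` S)) C" for C
      using closedin_continuous_map_preimage[OF cS that] SX by (simp add: Int_absorb1)
    let ?A = "{x \<in> S. f x \<in> A}" and ?B = "{x \<in> S. f x \<in> B}"
    have "S = ?A \<union> ?B" "?A \<inter> ?B = {}"
      using AB(1,2) by blast+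
    moreover have "A \<subseteq> f ` S" "B \<subseteq> f ` S"
      using AB(1) by simp_all
    then have "?A \<noteq> {}" "?B \<noteq> {}"
      using AB(3,4) by blast+
    moreover have "\<not> (\<exists>a\<in>?A. \<exists>b\<in>?B. (a, b) \<in> E \<or> (b, a) \<in> E)"
      using no hom by blast
    ultimately show ?thesis
      unfolding graph_disconnected_def using clS[OF cl(1)] clS[OF cl(2)] by meson
  qed
  moreover have "f ` S \<subseteq> topspace Y"
    using SX cont by (auto simp: continuous_map_def)
  ultimately show ?thesis
    using S by (auto simp: graph_connected_def)
qed

text \<open>A separation of the preimage of \<open>S\<close> cannot cut a fibre, so it is the preimage of a
  partition of \<open>S\<close>; surjectivity on edges shows that no edge joins the two parts, because a lift
  of such an edge would join the two parts of the preimage.\<close>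

lemma monotone_epi_of_connected_fibres:
  assumes epi: "graph_epi V E W F f"
    and fibre: "\<And>w. w \<in> W \<Longrightarrow> graph_connected (discrete_topology V) E {x \<in> V. f x = w}"
  shows "monotone_epi (discrete_topology V) E (discrete_topology W) F f"
proof -
  have "graph_connected (discrete_topology V) E {x \<in> V. f x \<in> S}"
    if S: "graph_connected (discrete_topology W) F S" for S
  proof (rule ccontr)
    have SW: "S \<subseteq> W"
      using S by (simp add: graph_connected_def)
    have surj: "f ` V = W" and edges: "map_prod f f ` E = F" and EV: "E \<subseteq> V \<times> V"
      using epi by (auto simp: graph_epi_def graph_hom_def is_graph_def)
    have sub: "{x \<in> V. f x \<in> S} \<subseteq> V" for S
      by blast
    assume "\<not> graph_connected (discrete_topology V) E {x \<in> V. f x \<in> S}"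
    then obtain A B where AB: "{x \<in> V. f x \<in> S} = A \<union> B" "A \<inter> B = {}" "A \<noteq> {}" "B \<noteq> {}"
      and no: "\<not> (\<exists>a\<in>A. \<exists>b\<in>B. (a, b) \<in> E \<or> (b, a) \<in> E)"
      by (auto simp: graph_connected_def graph_disconnected_discrete[OF sub])
    have AV: "A \<subseteq> V" "B \<subseteq> V" "f ` A \<subseteq> S" "f ` B \<subseteq> S"
      using AB(1) by blast+
    have disj: "f x \<noteq> f y" if xy: "x \<in> A" "y \<in> B" for x y
    proof
      assume eq: "f x = f y"
      let ?\<Phi> = "{z \<in> V. f z = f x}"
      have "f x \<in> S" "x \<in> V" "y \<in> V"
        using AB(1) xy by blast+
      moreover have "z \<in> A \<union> B" if "z \<in> V" "f z = f x" for z
        using that \<open>f x \<in> S\<close> unfolding AB(1)[symmetric] by simp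
      ultimately have "?\<Phi> = (?\<Phi> \<inter> A) \<union> (?\<Phi> \<inter> B)"
        by blast
      moreover have "\<not> (\<exists>a\<in>?\<Phi> \<inter> A. \<exists>b\<in>?\<Phi> \<inter> B. (a, b) \<in> E \<or> (b, a) \<in> E)"
        using no by blast
      moreover have "(?\<Phi> \<inter> A) \<inter> (?\<Phi> \<inter> B) = {}" "?\<Phi> \<inter> A \<noteq> {}" "?\<Phi> \<inter> B \<noteq> {}"
        using AB(2) xy \<open>x \<in> V\<close> \<open>y \<in> V\<close> eq by auto
      ultimately have "graph_disconnected (discrete_topology V) E ?\<Phi>"
        by (subst graph_disconnected_discrete) blast+
      moreover have "f x \<in> W"
        using \<open>f x \<in> S\<close> SW by blast
      ultimately show False
        using fibre[of "f x"] by (simp add: graph_connected_def)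
    qed
    have lift: "\<exists>a\<in>A. \<exists>b\<in>B. (a, b) \<in> E \<or> (b, a) \<in> E"
      if xy: "x \<in> A" "y \<in> B" "(f x, f y) \<in> F \<or> (f y, f x) \<in> F" for x y
    proof -
      obtain x' y' where x'y': "(x', y') \<in> E \<or> (y', x') \<in> E" "f x' = f x" "f y' = f y"
        using xy(3) edges by fastforce
      then have "x' \<in> V" "y' \<in> V"
        using EV by auto
      moreover have "f x' \<in> S" "f y' \<in> S"
        using xy AV x'y' by auto
      ultimately have "x' \<in> A \<union> B" "y' \<in> A \<union> B"
        using AB(1) by blast+
      then have "x' \<in> A" "y' \<in> B"
        using disj xy x'y' by (metis UnE)+
      then show ?thesis
        using x'y'(1) by blast
    qed
    have "S = f ` A \<union> f ` B"
      using AB(1) SW surj by blast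
    moreover have "f ` A \<inter> f ` B = {}" "f ` A \<noteq> {}" "f ` B \<noteq> {}"
      using disj AB(3,4) by auto
    moreover have "\<not> (\<exists>a\<in>f ` A. \<exists>b\<in>f ` B. (a, b) \<in> F \<or> (b, a) \<in> F)"
      using lift no by blast
    ultimately have "graph_disconnected (discrete_topology W) F S"
      using SW by (subst graph_disconnected_discrete) blast+
    then show False
      using S by (simp add: graph_connected_def)
  qed
  then show ?thesis
    using epi by (simp add: monotone_epi_def)
qed

section \<open>Dyck paths and their first peak\<close>

text \<open>The starting height is a parameter so that the condition splits along concatenations.\<close>

definition stays_nonneg :: "int \<Rightarrow> path \<Rightarrow> bool" where
  "stays_nonneg h P \<longleftrightarrow> (\<forall>i. 0 \<le> h + height (take i P))"

lemma height_simps [simp]: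
  "height [] = 0" "height (Up # P) = height P + 1" "height (Down # P) = height P - 1"
  "height (P @ Q) = height P + height Q" "height (replicate k Up) = int k"
  by (auto simp: height_def count_list_replicate_Up)

lemma stays_nonneg_Cons:
  "stays_nonneg h (s # P) \<longleftrightarrow> 0 \<le> h \<and> stays_nonneg (h + height [s]) P"
proof
  assume *: "stays_nonneg h (s # P)"
  have "0 \<le> h + height (take 0 (s # P))" "0 \<le> h + height (take (Suc i) (s # P))" for i
    using * unfolding stays_nonneg_def by blast+
  then show "0 \<le> h \<and> stays_nonneg (h + height [s]) P"
    unfolding stays_nonneg_def by (cases s) (auto simp: algebra_simps)
next
  assume *: "0 \<le> h \<and> stays_nonneg (h + height [s]) P"
  have "0 \<le> h + height (take i (s # P))" for i
    using * unfolding stays_nonneg_def by (cases i; cases s) (auto simp: algebra_simps)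
  then show "stays_nonneg h (s # P)"
    by (simp add: stays_nonneg_def)
qed

lemma stays_nonneg_simps [simp]:
  "stays_nonneg h [] \<longleftrightarrow> 0 \<le> h"
  "stays_nonneg h (Up # P) \<longleftrightarrow> 0 \<le> h \<and> stays_nonneg (h + 1) P"
  "stays_nonneg h (Down # P) \<longleftrightarrow> 0 \<le> h \<and> stays_nonneg (h - 1) P"
  by (simp_all add: stays_nonneg_Cons) (simp add: stays_nonneg_def)

lemma stays_nonneg_imp: "stays_nonneg h P \<Longrightarrow> 0 \<le> h"
  unfolding stays_nonneg_def by (drule spec[of _ 0]) simp

lemma stays_nonneg_append [simp]:
  "stays_nonneg h (P @ Q) \<longleftrightarrow> stays_nonneg h P \<and> stays_nonneg (h + height P) Q"
proof (induction P arbitrary: h)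
  case (Cons s P)
  then show ?case
    by (cases s) (auto simp: algebra_simps)
qed (auto dest: stays_nonneg_imp)

lemma stays_nonneg_replicate [simp]: "stays_nonneg h (replicate k Up) \<longleftrightarrow> 0 \<le> h"
proof (induction k arbitrary: h)
  case (Suc k)
  have "replicate (Suc k) Up = Up # replicate k Up"
    by simp
  then show ?case
    using Suc[of "h + 1"] by (simp only: stays_nonneg_simps) linarith
qed simp

lemma dyck_iff: "P \<in> dyck n \<longleftrightarrow> stays_nonneg 0 P \<and> height P = 0 \<and> count_list P Up = n"
  by (simp add: dyck_def stays_nonneg_def)

lemma finite_dyck: "finite (dyck n)"
proof (rule finite_subset)
  have len: "length P = count_list P Up + count_list P Down" for P
  proof (induction P)
    case (Cons s P)
    then show ?case
      by (cases s) auto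
  qed simp
  have "s \<in> {Up, Down}" for s
    by (cases s) auto
  then show "dyck n \<subseteq> {P. set P \<subseteq> {Up, Down} \<and> length P = 2 * n}"
    by (auto simp: dyck_def height_def len)
qed (rule finite_lists_length_eq, simp)

lemma down_split:
  assumes "Down \<in> set P"
  obtains a R where "P = replicate a Up @ Down # R"
proof -
  obtain Q R where "P = Q @ Down # R" "Down \<notin> set Q"
    using assms by (meson split_list_first)
  moreover have "s = Up" if "s \<in> set Q" for s
    using that \<open>Down \<notin> set Q\<close> by (metis step.exhaust)
  then have "Q = replicate (length Q) Up"
    by (simp add: replicate_length_same)
  ultimately show thesis
    using that by metis
qed

lemma first_peak_split:
  assumes P: "stays_nonneg 0 P" and "Down \<in> set P"
  obtains a R where "P = replicate a Up @ Up # Down # R"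
proof -
  obtain a R where a: "P = replicate a Up @ Down # R"
    using assms(2) by (rule down_split)
  with P have "a \<noteq> 0"
    by (auto dest: stays_nonneg_imp)
  then obtain b where "a = Suc b"
    using not0_implies_Suc by blast
  then show thesis
    using a that[of b R] by (simp add: replicate_append_same[symmetric])
qed

lemma delete_first_peak_eq:
  "delete_first_peak (replicate a Up @ Up # Down # R) = replicate a Up @ R"
proof (induction a)
  case (Suc a)
  then show ?case
    by (cases a) auto
qed simp

text \<open>Inserting or deleting a peak at the end of an initial run of up steps leaves all
  other heights alone, and the new height is positive. This one equivalence serves the map, its section and
  the description of its fibres.\<close>

lemma dyck_peak_iff:
  "replicate a Up @ Up # Down # R \<in> dyck (Suc n) \<longleftrightarrow> replicate a Up @ R \<in> dyck n"
  by (auto simp: dyck_iff)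

lemma dyck_first_peak:
  assumes "P \<in> dyck (Suc n)"
  obtains a R where "P = replicate a Up @ Up # Down # R" "replicate a Up @ R \<in> dyck n"
    "delete_first_peak P = replicate a Up @ R"
proof -
  have "Down \<in> set P"
  proof (rule ccontr)
    assume "Down \<notin> set P"
    then have "height P = int (Suc n)"
      using assms by (simp add: height_def dyck_def)
    then show False
      using assms by (simp add: dyck_def)
  qed
  then obtain a R where "P = replicate a Up @ Up # Down # R"
    using first_peak_split assms dyck_iff by metis
  then show thesis
    using that assms dyck_peak_iff delete_first_peak_eq by metis
qed

lemma delete_first_peak_dyck: "P \<in> dyck (Suc n) \<Longrightarrow> delete_first_peak P \<in> dyck n"
  by (erule dyck_first_peak) simp

lemma prepend_peak:
  assumes "P \<in> dyck n"
  shows "Up # Down # P \<in> dyck (Suc n)" "delete_first_peak (Up # Down # P) = P"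
  using assms dyck_peak_iff[of 0 P n] by auto

lemma ascent_coverI:
  assumes "P = A @ [Down] @ replicate k Up @ [Down] @ B"
    and "Q = A @ replicate k Up @ [Down, Down] @ B"
    and "k \<noteq> 0" "P \<in> dyck n" "Q \<in> dyck n"
  shows "(P, Q) \<in> ascent_cover n"
  unfolding ascent_cover_def mem_Collect_eq prod.case
  using assms by (intro conjI exI[of _ A] exI[of _ B] exI[of _ k]) auto

lemma ascent_coverE:
  assumes "(P, Q) \<in> ascent_cover n"
  obtains A B k where "k \<noteq> 0" "P = A @ [Down] @ replicate k Up @ [Down] @ B"
    "Q = A @ replicate k Up @ [Down, Down] @ B" "P \<in> dyck n" "Q \<in> dyck n"
proof -
  have "\<exists>A B k. k \<ge> 1 \<and> P = A @ [Down] @ replicate k Up @ [Down] @ B \<and>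
      Q = A @ replicate k Up @ [Down, Down] @ B" "P \<in> dyck n" "Q \<in> dyck n"
    using assms unfolding ascent_cover_def mem_Collect_eq prod.case by blast+
  then show thesis
    using that by (metis not_one_le_zero)
qed

text \<open>The lifting of covers behind surjectivity on edges: the new peak comes before the factor
  that the cover changes.\<close>

lemma prepend_peak_cover:
  assumes "(P, Q) \<in> ascent_cover n"
  shows "(Up # Down # P, Up # Down # Q) \<in> ascent_cover (Suc n)"
proof -
  obtain A B k where k: "k \<noteq> 0" and
    P: "P = A @ [Down] @ replicate k Up @ [Down] @ B" and
    Q: "Q = A @ replicate k Up @ [Down, Down] @ B"
    using assms by (rule ascent_coverE)
  have "Up # Down # P = (Up # Down # A) @ [Down] @ replicate k Up @ [Down] @ B"
    "Up # Down # Q = (Up # Down # A) @ replicate k Up @ [Down, Down] @ B"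
    by (simp_all add: P Q)
  moreover have "Up # Down # P \<in> dyck (Suc n)" "Up # Down # Q \<in> dyck (Suc n)"
    using assms prepend_peak(1) by (auto simp: ascent_cover_def)
  ultimately show ?thesis
    using k ascent_coverI by blast
qed

text \<open>If a down step precedes the factor \<open>D U\<^sup>k D\<close>, the first peak lies outside the factor and its
  deletion commutes with the cover. Otherwise the leading \<open>D\<close> of the factor ends the first peak, and
  \<open>U\<^sup>a U D U\<^sup>k D B\<close> and \<open>U\<^sup>a U U\<^sup>k D D B\<close> both become \<open>U\<^sup>a U\<^sup>k D B\<close>.\<close>

lemma delete_first_peak_cover:
  assumes "(P, Q) \<in> ascent_cover (Suc n)"
  shows "delete_first_peak P = delete_first_peak Q \<or>
    (delete_first_peak P, delete_first_peak Q) \<in> ascent_cover n"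
proof -
  obtain A B k where k: "k \<noteq> 0" and
    P: "P = A @ [Down] @ replicate k Up @ [Down] @ B" and
    Q: "Q = A @ replicate k Up @ [Down, Down] @ B" and
    PQ: "P \<in> dyck (Suc n)" "Q \<in> dyck (Suc n)"
    using assms by (rule ascent_coverE)
  have nonneg: "stays_nonneg 0 (A @ [Down])"
    using PQ(1) unfolding P dyck_iff by simp
  show ?thesis
  proof (cases "Down \<in> set A")
    case True
    then obtain a R where A: "A = replicate a Up @ Up # Down # R"
      using first_peak_split nonneg stays_nonneg_append by blast
    have "delete_first_peak P =
        (replicate a Up @ R) @ [Down] @ replicate k Up @ [Down] @ B"
      "delete_first_peak Q = (replicate a Up @ R) @ replicate k Up @ [Down, Down] @ B"
      by (simp_all add: P Q A delete_first_peak_eq)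
    then have "(delete_first_peak P, delete_first_peak Q) \<in> ascent_cover n"
      using k PQ[THEN delete_first_peak_dyck] ascent_coverI by blast
    then show ?thesis ..
  next
    case False
    obtain a R where aR: "A @ [Down] = replicate a Up @ Up # Down # R"
      using first_peak_split[OF nonneg] by auto
    have "R = []"
    proof (rule ccontr)
      assume "R \<noteq> []"
      then have "butlast (A @ [Down]) = replicate a Up @ Up # Down # butlast R"
        unfolding aR by (simp add: butlast_append)
      then show False
        using False by auto
    qed
    then have A: "A = replicate a Up @ [Up]"
      using aR by auto
    have "Q = replicate (a + k) Up @ Up # Down # Down # B"
      by (simp add: Q A replicate_add replicate_append_same)
    then have "delete_first_peak Q = replicate (a + k) Up @ Down # B"
      using delete_first_peak_eq by simp
    moreover have "delete_first_peak P = replicate (a + k) Up @ Down # B"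
      by (simp add: P A delete_first_peak_eq replicate_add)
    ultimately show ?thesis
      by simp
  qed
qed

text \<open>The centre \<open>t\<close> has its extra peak inserted at the top of the first ascent of \<open>w\<close>. A path of the
  fibre with the peak inserted lower has the form \<open>U\<^sup>a U D U\<^sup>k D S\<close>, and its ascent cover at the
  first down step is \<open>t\<close>.\<close>

lemma dyck_fibre_star:
  assumes "w \<in> dyck n" "1 \<le> n"
  obtains t where "t \<in> dyck (Suc n)" "delete_first_peak t = w"
    "\<And>P. P \<in> dyck (Suc n) \<Longrightarrow> delete_first_peak P = w \<Longrightarrow>
       P = t \<or> (P, t) \<in> ascent_cover (Suc n)"
proof -
  obtain m where "n = Suc m"
    using assms(2) by (cases n) auto
  then obtain b S where "w = replicate b Up @ Up # Down # S"
    using assms(1) dyck_first_peak by metis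
  then have w: "w = replicate (Suc b) Up @ Down # S"
    by (simp add: replicate_app_Cons_same)
  define t where "t = replicate (Suc b) Up @ Up # Down # Down # S"
  have t: "t \<in> dyck (Suc n)" "delete_first_peak t = w"
    using assms(1) unfolding t_def dyck_peak_iff delete_first_peak_eq w by simp_all
  have "P = t \<or> (P, t) \<in> ascent_cover (Suc n)"
    if P: "P \<in> dyck (Suc n)" "delete_first_peak P = w" for P
  proof -
    obtain a R where PR: "P = replicate a Up @ Up # Down # R"
      and eq: "replicate a Up @ R = replicate (Suc b) Up @ Down # S"
      using P dyck_first_peak w by metis
    obtain us where "replicate a Up = replicate (Suc b) Up @ us \<and> us @ R = Down # S \<or>
        replicate a Up @ us = replicate (Suc b) Up \<and> R = us @ Down # S"
      using eq append_eq_append_conv2 by meson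
    then have us: "replicate a Up @ us = replicate (Suc b) Up \<and> R = us @ Down # S"
    proof
      \<comment> \<open>the peak cannot be inserted beyond the first down step, so \<open>us\<close> is empty here\<close>
      assume *: "replicate a Up = replicate (Suc b) Up @ us \<and> us @ R = Down # S"
      then have "Down \<notin> set us"
        by (metis Un_iff in_set_replicate set_append step.distinct(1))
      with * have "us = []"
        by (cases us) auto
      with * show ?thesis
        by simp
    qed
    define k where "k = length us"
    have "set us \<subseteq> {Up}"
      using us by (metis Un_subset_iff set_append set_replicate_Suc subset_refl)
    then have k: "us = replicate k Up"
      unfolding k_def by (metis replicate_length_same singletonD subsetD)
    show ?thesis
    proof (cases "k = 0")
      case True
      then show ?thesis
        using us k by (simp add: PR t_def)
    next
      case False
      have "P = (replicate a Up @ [Up]) @ [Down] @ replicate k Up @ [Down] @ S"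
        by (simp add: PR us k)
      moreover have "t = (replicate a Up @ [Up]) @ replicate k Up @ [Down, Down] @ S"
      proof -
        have "t = (replicate (Suc b) Up @ [Up]) @ [Down, Down] @ S"
          by (simp add: t_def)
        also have "replicate (Suc b) Up @ [Up] = replicate a Up @ (us @ [Up])"
          using us by (metis append_assoc)
        also have "us @ [Up] = Up # us"
          by (simp add: k replicate_append_same)
        finally show ?thesis
          by (simp add: k)
      qed
      ultimately show ?thesis
        using False P(1) t(1) ascent_coverI by blast
    qed
  qed
  then show thesis
    using that t by blast
qed

lemma hasse_edges_dyck:
  "(P, Q) \<in> hasse_edges (dyck n) (ascent_order n) \<longleftrightarrow>
     P \<in> dyck n \<and> Q \<in> dyck n \<and>
     (P = Q \<or> (P, Q) \<in> ascent_cover n \<or> (Q, P) \<in> ascent_cover n)"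
  unfolding hasse_edges_def covers_ascent_order_iff by blast

lemma is_graph_hasse_edges: "is_graph V (hasse_edges V r)"
  unfolding is_graph_def hasse_edges_def by (auto simp: refl_on_def intro!: symI)

lemma delete_first_peak_image: "delete_first_peak ` dyck (Suc n) = dyck n"
  using delete_first_peak_dyck prepend_peak by (blast intro: image_eqI[OF sym])

lemma poset_epi_delete_first_peak:
  "poset_epi (dyck (Suc n)) (ascent_order (Suc n)) (dyck n) (ascent_order n) delete_first_peak"
proof -
  have "(delete_first_peak P, delete_first_peak Q) \<in> (ascent_cover n)\<^sup>*"
    if "(P, Q) \<in> (ascent_cover (Suc n))\<^sup>*" for P Q
    using that
  proof induction
    case (step Q R)
    then show ?case
      using delete_first_peak_cover by (metis rtrancl.simps)
  qed simp
  then show ?thesis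
    using delete_first_peak_image delete_first_peak_dyck
    unfolding poset_epi_def by (simp add: partial_order_ascent_order) (auto simp: ascent_order_def)
qed

lemma graph_epi_delete_first_peak:
  "graph_epi (dyck (Suc n)) (hasse_edges (dyck (Suc n)) (ascent_order (Suc n)))
     (dyck n) (hasse_edges (dyck n) (ascent_order n)) delete_first_peak"
proof -
  let ?E = "\<lambda>n. hasse_edges (dyck n) (ascent_order n)"
  have hom: "(delete_first_peak P, delete_first_peak Q) \<in> ?E n" if "(P, Q) \<in> ?E (Suc n)" for P Q
    using that delete_first_peak_dyck[of _ n] delete_first_peak_cover[of _ _ n]
    unfolding hasse_edges_dyck by metis
  have lift: "(P, Q) \<in> map_prod delete_first_peak delete_first_peak ` ?E (Suc n)"
    if "(P, Q) \<in> ?E n" for P Q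
  proof
    show "(Up # Down # P, Up # Down # Q) \<in> ?E (Suc n)"
      using that prepend_peak(1) prepend_peak_cover unfolding hasse_edges_dyck by blast
  qed simp
  have "map_prod delete_first_peak delete_first_peak ` ?E (Suc n) = ?E n"
    using hom lift by fast
  moreover have "delete_first_peak \<in> dyck (Suc n) \<rightarrow> dyck n"
    using delete_first_peak_dyck by blast
  ultimately show ?thesis
    using hom by (simp add: graph_epi_def graph_hom_def is_graph_hasse_edges delete_first_peak_image)
qed

lemma monotone_epi_delete_first_peak:
  assumes "1 \<le> n"
  shows "monotone_epi
     (discrete_topology (dyck (Suc n))) (hasse_edges (dyck (Suc n)) (ascent_order (Suc n)))
     (discrete_topology (dyck n)) (hasse_edges (dyck n) (ascent_order n)) delete_first_peak"
proof (rule monotone_epi_of_connected_fibres[OF graph_epi_delete_first_peak])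
  fix w assume "w \<in> dyck n"
  then obtain t where t: "t \<in> dyck (Suc n)" "delete_first_peak t = w"
    "\<And>P. P \<in> dyck (Suc n) \<Longrightarrow> delete_first_peak P = w \<Longrightarrow>
       P = t \<or> (P, t) \<in> ascent_cover (Suc n)"
    using assms by (rule dyck_fibre_star) blast
  show "graph_connected (discrete_topology (dyck (Suc n)))
      (hasse_edges (dyck (Suc n)) (ascent_order (Suc n)))
      {P \<in> dyck (Suc n). delete_first_peak P = w}"
    by (rule graph_connected_star[of _ _ t]) (use t in \<open>auto simp: hasse_edges_dyck\<close>)
qed

lemma dyck_1: "dyck 1 = {[Up, Down]}"
proof -
  have "dyck 0 = {[]}"
  proof -
    have "P = []" if "P \<in> dyck 0" for P
    proof (cases P)
      case (Cons s Q)
      then show ?thesis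
        using that by (cases s) (auto simp: dyck_iff dest: stays_nonneg_imp)
    qed simp
    then show ?thesis
      by (auto simp: dyck_iff)
  qed
  moreover have "P = [Up, Down]" if "P \<in> dyck (Suc 0)" for P
    using dyck_first_peak[OF that] calculation by auto
  ultimately show ?thesis
    by (auto simp: dyck_iff)
qed

section \<open>Inverse systems of finite graphs with monotone bonding maps\<close>

locale monotone_system =
  fixes V :: "nat \<Rightarrow> 'a set" and E :: "nat \<Rightarrow> ('a \<times> 'a) set" and f :: "nat \<Rightarrow> 'a \<Rightarrow> 'a"
  assumes finite_verts: "\<And>n. 1 \<le> n \<Longrightarrow> finite (V n)"
    and first_connected: "graph_connected (discrete_topology (V 1)) (E 1) (V 1)"
    and bonding: "\<And>n. 1 \<le> n \<Longrightarrow>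
      monotone_epi (discrete_topology (V (Suc n))) (E (Suc n)) (discrete_topology (V n)) (E n)
        (f (Suc n))"
begin

abbreviation "X \<equiv> inv_limit_topology V f"
abbreviation "\<E> \<equiv> inv_limit_edges V E f"
abbreviation "L \<equiv> inv_limit_verts V f"

lemma is_graph: "1 \<le> n \<Longrightarrow> is_graph (V n) (E n)"
  using bonding[of n] by (simp add: monotone_epi_def graph_epi_def graph_hom_def)

lemma bonding_surj: "1 \<le> n \<Longrightarrow> f (Suc n) ` V (Suc n) = V n"
  using bonding[of n] by (simp add: monotone_epi_def graph_epi_def)

lemma bonding_edge: "1 \<le> n \<Longrightarrow> (u, v) \<in> E (Suc n) \<Longrightarrow> (f (Suc n) u, f (Suc n) v) \<in> E n"
  using bonding[of n] by (simp add: monotone_epi_def graph_epi_def graph_hom_def)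

text \<open>A reindexing from the pairs \<open>n - 1, n\<close> with \<open>n \<ge> 2\<close> to \<open>n, n + 1\<close> with \<open>n \<ge> 1\<close>, which avoids
  truncated subtraction.\<close>

lemma verts_iff:
  "x \<in> L \<longleftrightarrow> x \<in> PiE {1..} V \<and> (\<forall>n\<ge>1. f (Suc n) (x (Suc n)) = x n)"
proof -
  have "(\<forall>n\<ge>2. x (n - 1) = f n (x n)) \<longleftrightarrow> (\<forall>n\<ge>1. f (Suc n) (x (Suc n)) = x n)"
    by (metis One_nat_def Suc_1 Suc_le_D Suc_le_mono diff_Suc_1)
  then show ?thesis
    by (simp add: inv_limit_verts_def)
qed

lemma vert_mem: "x \<in> L \<Longrightarrow> 1 \<le> n \<Longrightarrow> x n \<in> V n"
  by (auto simp: verts_iff)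

lemma vert_bonding: "x \<in> L \<Longrightarrow> 1 \<le> n \<Longrightarrow> f (Suc n) (x (Suc n)) = x n"
  by (simp add: verts_iff)

lemma verts_eqI:
  assumes "x \<in> L" "y \<in> L" "\<And>n. 1 \<le> n \<Longrightarrow> x n = y n"
  shows "x = y"
  using assms by (intro PiE_ext[of x "{1..}" V]) (auto simp: verts_iff)

lemma vert_eq_below:
  assumes "x \<in> L" "y \<in> L" "1 \<le> m" "m \<le> n" "x n = y n"
  shows "x m = y m"
  using assms(4,5)
proof (induction n rule: dec_induct)
  case (step n)
  then show ?case
    using assms(1-3) vert_bonding by (metis order_trans)
qed simp

lemma edge_below:
  assumes "x \<in> L" "y \<in> L" "1 \<le> m" "m \<le> n" "(x n, y n) \<in> E n"
  shows "(x m, y m) \<in> E m"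
  using assms(4,5)
proof (induction n rule: dec_induct)
  case (step n)
  then have "(f (Suc n) (x (Suc n)), f (Suc n) (y (Suc n))) \<in> E n"
    using assms(3) bonding_edge by (meson order_trans)
  then show ?case
    using step assms(1-3) vert_bonding by (simp add: order_trans)
qed simp

text \<open>Below level \<open>n\<close> the thread is forced by the bonding maps; above it, surjectivity of the
  bonding maps allows it to be chosen step by step.\<close>

lemma vert_through:
  assumes "1 \<le> n" "v \<in> V n"
  obtains x where "x \<in> L" "x n = v"
proof -
  have below: "\<exists>w. w n = u \<and> (\<forall>k. 1 \<le> k \<and> k \<le> n \<longrightarrow> w k \<in> V k) \<and>
      (\<forall>k. 1 \<le> k \<and> k < n \<longrightarrow> f (Suc k) (w (Suc k)) = w k)" if "u \<in> V n" for u
    using assms(1) that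
  proof (induction n arbitrary: u rule: dec_induct)
    case base
    then show ?case
      by (intro exI[of _ "\<lambda>_. u"]) auto
  next
    case (step n)
    then have "f (Suc n) u \<in> V n"
      using bonding_surj[of n] imageI[of u "V (Suc n)" "f (Suc n)"] by simp
    then obtain w where w: "w n = f (Suc n) u" "\<forall>k. 1 \<le> k \<and> k \<le> n \<longrightarrow> w k \<in> V k"
      "\<forall>k. 1 \<le> k \<and> k < n \<longrightarrow> f (Suc k) (w (Suc k)) = w k"
      using step.IH by blast
    then show ?case
      using step.prems by (intro exI[of _ "w(Suc n := u)"]) (auto simp: le_Suc_eq less_Suc_eq)
  qed
  obtain w where w: "w n = v" "\<forall>k. 1 \<le> k \<and> k \<le> n \<longrightarrow> w k \<in> V k"
      "\<forall>k. 1 \<le> k \<and> k < n \<longrightarrow> f (Suc k) (w (Suc k)) = w k"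
    using below[OF assms(2)] by blast
  have "\<exists>y. \<forall>j. (y j \<in> V (n + j) \<and> (j = 0 \<longrightarrow> y j = v)) \<and> f (Suc (n + j)) (y (Suc j)) = y j"
  proof (rule dependent_nat_choice)
    show "\<exists>u. u \<in> V (n + 0) \<and> (0 = (0::nat) \<longrightarrow> u = v)"
      using assms(2) by simp
    fix u j assume "u \<in> V (n + j) \<and> (j = 0 \<longrightarrow> u = v)"
    then have "u \<in> f (Suc (n + j)) ` V (Suc (n + j))"
      using bonding_surj[of "n + j"] assms(1) by simp
    then show "\<exists>u'. (u' \<in> V (n + Suc j) \<and> (Suc j = 0 \<longrightarrow> u' = v)) \<and> f (Suc (n + j)) u' = u"
      by auto
  qed
  then obtain y where y: "y 0 = v" "\<And>j. y j \<in> V (n + j)"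
    "\<And>j. f (Suc (n + j)) (y (Suc j)) = y j"
    by blast
  define x where "x k = (if k = 0 then undefined else if k \<le> n then w k else y (k - n))" for k
  have xy: "x (n + j) = y j" for j
    using assms(1) y(1) w(1) by (simp add: x_def)
  have "x k \<in> V k" if "1 \<le> k" for k
  proof (cases "k \<le> n")
    case True
    then show ?thesis
      using w(2) that by (simp add: x_def)
  next
    case False
    then have "k = n + (k - n)"
      by simp
    then show ?thesis
      using xy y(2) by metis
  qed
  moreover have "f (Suc k) (x (Suc k)) = x k" if "1 \<le> k" for k
  proof (cases "k < n")
    case True
    then show ?thesis
      using w(3) that by (simp add: x_def)
  next
    case False
    then have "k = n + (k - n)"
      by simp
    then show ?thesis
      using xy y(3) by (metis add_Suc_right)
  qed
  moreover have "x \<in> extensional {1..}"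
    by (simp add: extensional_def x_def)
  ultimately have "x \<in> L"
    by (simp add: verts_iff PiE_iff)
  then show thesis
    using that[of x] assms(1) w(1) by (simp add: x_def)
qed

subsection \<open>The limit as a topological graph\<close>

lemma topspace_limit: "topspace X = L"
  by (auto simp: inv_limit_topology_def inv_limit_verts_def)

lemma continuous_projection:
  "1 \<le> n \<Longrightarrow> continuous_map X (discrete_topology (V n)) (\<lambda>x. x n)"
  unfolding inv_limit_topology_def
  by (intro continuous_map_from_subtopology continuous_map_product_projection) simp

lemma continuous_projection_pair:
  assumes "1 \<le> n"
  shows "continuous_map (prod_topology X X) (discrete_topology (V n \<times> V n)) (\<lambda>(x, y). (x n, y n))"
  using continuous_projection[OF assms]
  by (simp add: prod_topology_discrete_topology continuous_map_prod_top)

lemma closedin_projection_pair: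
  assumes "1 \<le> n"
  shows "closedin (prod_topology X X) {(x, y). x \<in> L \<and> y \<in> L \<and> (x n, y n) \<in> R}"
proof -
  let ?S = "R \<inter> V n \<times> V n"
  have "closedin (prod_topology X X)
      {p \<in> topspace (prod_topology X X). (\<lambda>(x, y). (x n, y n)) p \<in> ?S}"
    by (rule closedin_continuous_map_preimage[OF continuous_projection_pair[OF assms]]) simp
  also have "{p \<in> topspace (prod_topology X X). (\<lambda>(x, y). (x n, y n)) p \<in> ?S} =
      {(x, y). x \<in> L \<and> y \<in> L \<and> (x n, y n) \<in> R}"
    using assms vert_mem by (auto simp: topspace_limit)
  finally show ?thesis .
qed

lemma clopen_cylinder:
  assumes "1 \<le> n"
  shows "openin X {x \<in> L. x n \<in> S}" "closedin X {x \<in> L. x n \<in> S}"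
proof -
  have eq: "{x \<in> L. x n \<in> S} = {x \<in> topspace X. x n \<in> S \<inter> V n}"
    using assms vert_mem by (auto simp: topspace_limit)
  show "openin X {x \<in> L. x n \<in> S}"
    unfolding eq by (rule openin_continuous_map_preimage[OF continuous_projection[OF assms]]) simp
  show "closedin X {x \<in> L. x n \<in> S}"
    unfolding eq by (rule closedin_continuous_map_preimage[OF continuous_projection[OF assms]]) simp
qed

text \<open>A basic open set of the product restricts finitely many coordinates, and a coordinate of a
  thread determines all earlier ones. So one sufficiently high coordinate is enough.\<close>

lemma cylinder_basis:
  assumes "openin X U" "x \<in> U"
  obtains n where "1 \<le> n" "{y \<in> L. y n = x n} \<subseteq> U"
proof -
  obtain T where T: "openin (product_topology (\<lambda>n. discrete_topology (V n)) {1..}) T"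
    and U: "U = T \<inter> L"
    using assms(1) by (auto simp: inv_limit_topology_def openin_subtopology)
  then obtain W where W: "finite {i \<in> {1..}. W i \<noteq> V i}" "x \<in> PiE {1..} W" "PiE {1..} W \<subseteq> T"
    using assms(2) unfolding openin_product_topology_alt by auto
  obtain n where n: "{i \<in> {1..}. W i \<noteq> V i} \<subseteq> {..n}"
    using W(1) finite_nat_iff_bounded_le by blast
  have "y \<in> U" if y: "y \<in> L" "y (Suc n) = x (Suc n)" for y
  proof -
    have "y i \<in> W i" if "1 \<le> i" for i
    proof (cases "i \<le> n")
      case True
      then have "y i = x i"
        using vert_eq_below[of y x i "Suc n"] y assms(2) U that by simp
      then show ?thesis
        using W(2) that by auto
    next
      case False
      then have "i \<notin> {i \<in> {1..}. W i \<noteq> V i}"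
        using n subsetD by (metis atMost_iff)
      then have "W i = V i"
        using that by simp
      then show ?thesis
        using y(1) vert_mem that by blast
    qed
    moreover have "y \<in> extensional {1..}"
      using y(1) by (auto simp: verts_iff PiE_def)
    ultimately show ?thesis
      using W(3) y(1) U by (auto simp: PiE_def)
  qed
  then show thesis
    using that[of "Suc n"] by auto
qed

lemma compact_limit: "compact_space X"
proof -
  let ?P = "product_topology (\<lambda>n. discrete_topology (V n)) {1..}"
  have "compact_space ?P"
    using finite_verts by (simp add: compact_space_product_topology compact_space_discrete_topology)
  moreover have "closedin ?P L"
  proof -
    have "closedin ?P {x \<in> topspace ?P. f (Suc n) (x (Suc n)) = x n}" if n: "1 \<le> n" for n
    proof (rule closedin_continuous_maps_eq)
      show "Hausdorff_space (discrete_topology (V n))"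
        by simp
      have proj: "continuous_map ?P (discrete_topology (V (Suc n))) (\<lambda>x. x (Suc n))"
        by (rule continuous_map_product_projection) simp
      have "continuous_map (discrete_topology (V (Suc n))) (discrete_topology (V n)) (f (Suc n))"
        using bonding_surj[OF n] by auto
      then show "continuous_map ?P (discrete_topology (V n)) (\<lambda>x. f (Suc n) (x (Suc n)))"
        by (rule continuous_map_compose[OF proj, unfolded o_def])
      show "continuous_map ?P (discrete_topology (V n)) (\<lambda>x. x n)"
        by (rule continuous_map_product_projection) (use n in simp)
    qed
    then have clo: "closedin ?P (\<Inter>n\<in>{1..}. {x \<in> topspace ?P. f (Suc n) (x (Suc n)) = x n})"
      by (intro closedin_INT) auto
    have "x \<in> (\<Inter>n\<in>{1..}. {x \<in> topspace ?P. f (Suc n) (x (Suc n)) = x n}) \<longleftrightarrow> x \<in> L" for x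
      using order_refl[of "1::nat"] unfolding verts_iff INT_iff mem_Collect_eq atLeast_iff
        topspace_product_topology topspace_discrete_topology by blast
    then have "(\<Inter>n\<in>{1..}. {x \<in> topspace ?P. f (Suc n) (x (Suc n)) = x n}) = L"
      by (rule set_eqI)
    with clo show ?thesis
      by simp
  qed
  ultimately show ?thesis
    by (simp add: inv_limit_topology_def closedin_compact_space compact_space_subtopology)
qed

lemma topological_graph_limit: "topological_graph X \<E>"
  unfolding topological_graph_def
proof (intro conjI)
  have "\<exists>U. a \<in> U \<and> U \<subseteq> W \<and> closedin X U \<and> openin X U" if W: "openin X W" "a \<in> W" for W a
  proof -
    obtain n where n: "1 \<le> n" "{y \<in> L. y n = a n} \<subseteq> W"
      using W by (rule cylinder_basis)
    have "a \<in> L"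
      using W openin_subset topspace_limit by blast
    then show ?thesis
      using n clopen_cylinder[OF n(1), of "{a n}"] by (intro exI[of _ "{y \<in> L. y n = a n}"]) auto
  qed
  then show "X dim_le 0"
    unfolding dimension_le_0_neighbourhood_base_of_clopen
    by (subst open_neighbourhood_base_of) blast+
  show "compact_space X"
    by (rule compact_limit)
  show "Hausdorff_space X"
    unfolding inv_limit_topology_def
    by (intro Hausdorff_space_subtopology) (simp add: Hausdorff_space_product_topology)
  show "second_countable_space X"
    unfolding second_countable_space_def
  proof (intro exI[of _ "(\<lambda>(n, v). {y \<in> L. y n = v}) ` (SIGMA n:{1..}. V n)"] conjI ballI allI impI)
    show "countable ((\<lambda>(n, v). {y \<in> L. y n = v}) ` (SIGMA n:{1..}. V n))"
      using finite_verts by (intro countable_image countable_SIGMA) (auto intro: countable_finite)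
    show "openin X U" if "U \<in> (\<lambda>(n, v). {y \<in> L. y n = v}) ` (SIGMA n:{1..}. V n)" for U
      using that clopen_cylinder(1)[where S = "{v}" for v] by auto
    fix U x assume Ux: "openin X U \<and> x \<in> U"
    then obtain n where n: "1 \<le> n" "{y \<in> L. y n = x n} \<subseteq> U"
      using cylinder_basis by blast
    have "x \<in> L"
      using Ux openin_subset topspace_limit by blast
    then show "\<exists>W\<in>(\<lambda>(n, v). {y \<in> L. y n = v}) ` (SIGMA n:{1..}. V n). x \<in> W \<and> W \<subseteq> U"
      using n vert_mem by (intro bexI[of _ "{y \<in> L. y n = x n}"]) auto
  qed
  have "(x, x) \<in> \<E>" if "x \<in> L" for x
    using that is_graph vert_mem[OF that]
    by (simp add: inv_limit_edges_def is_graph_def refl_on_def)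
  moreover have "(y, x) \<in> \<E>" if "(x, y) \<in> \<E>" for x y
    using that is_graph by (simp add: inv_limit_edges_def is_graph_def sym_def)
  moreover have "\<E> \<subseteq> L \<times> L"
    by (auto simp: inv_limit_edges_def)
  ultimately show "is_graph (topspace X) \<E>"
    unfolding is_graph_def topspace_limit refl_on_def sym_def by blast
  have "(x, y) \<in> \<E> \<longleftrightarrow> (\<forall>n\<ge>1. x \<in> L \<and> y \<in> L \<and> (x n, y n) \<in> E n)" for x y
    using order_refl[of "1::nat"] unfolding inv_limit_edges_def mem_Collect_eq prod.case by blast
  then have "p \<in> \<E> \<longleftrightarrow> p \<in> (\<Inter>n\<in>{1..}. {(x, y). x \<in> L \<and> y \<in> L \<and> (x n, y n) \<in> E n})" for p
    by (cases p) auto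
  then have "\<E> = (\<Inter>n\<in>{1..}. {(x, y). x \<in> L \<and> y \<in> L \<and> (x n, y n) \<in> E n})"
    by (rule set_eqI)
  moreover have "closedin (prod_topology X X)
      (\<Inter>n\<in>{1..}. {(x, y). x \<in> L \<and> y \<in> L \<and> (x n, y n) \<in> E n})"
    using closedin_projection_pair by (intro closedin_INT) auto
  ultimately show "closedin (prod_topology X X) \<E>"
    by simp
qed

text \<open>The compactness argument of the whole development: the pairs of \<open>C\<close> that satisfy \<open>R\<close> at
  level \<open>n\<close> form a decreasing sequence of nonempty closed sets. It is used with the edge relations
  to find an edge between two parts of a separation, and with equality to show that cylinders are
  uniformly small.\<close>

lemma closed_relation_limit:
  assumes C: "closedin (prod_topology X X) C"
    and meets: "\<And>n. 1 \<le> n \<Longrightarrow> \<exists>(x, y)\<in>C. x \<in> L \<and> y \<in> L \<and> (x n, y n) \<in> R n"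
    and R: "\<And>x y m n. x \<in> L \<Longrightarrow> y \<in> L \<Longrightarrow> 1 \<le> m \<Longrightarrow> m \<le> n \<Longrightarrow> (x n, y n) \<in> R n \<Longrightarrow> (x m, y m) \<in> R m"
  obtains x y where "(x, y) \<in> C" "x \<in> L" "y \<in> L" "\<And>n. 1 \<le> n \<Longrightarrow> (x n, y n) \<in> R n"
proof -
  define D where "D n = C \<inter> {(x, y). x \<in> L \<and> y \<in> L \<and> (x (Suc n), y (Suc n)) \<in> R (Suc n)}" for n
  have "(\<Inter>n. D n) \<noteq> {}"
  proof (rule compact_space_imp_nest)
    show "compact_space (prod_topology X X)"
      using compact_limit by (simp add: compact_space_prod_topology)
    show "closedin (prod_topology X X) (D n)" for n
      unfolding D_def using C by (intro closedin_Int closedin_projection_pair) auto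
    show "D n \<noteq> {}" for n
      using meets[of "Suc n"] by (auto simp: D_def)
    have "D n \<subseteq> D m" if "m \<le> n" for m n
      using R[of _ _ "Suc m" "Suc n"] that by (auto simp: D_def)
    then show "decseq D"
      by (simp add: decseq_def)
  qed
  then obtain x y where xy: "(x, y) \<in> D n" for n
    by fastforce
  have "(x n, y n) \<in> R n" if "1 \<le> n" for n
    using xy[of "n - 1"] that by (simp add: D_def)
  then show thesis
    using that[of x y] xy[of 0] by (simp add: D_def)
qed

lemma bonding_monotone:
  assumes "1 \<le> n" "graph_connected (discrete_topology (V n)) (E n) S"
  shows "graph_connected (discrete_topology (V (Suc n))) (E (Suc n)) {v \<in> V (Suc n). f (Suc n) v \<in> S}"
  using bonding[OF assms(1)] assms(2) by (auto simp: monotone_epi_def graph_connected_def)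

text \<open>The image of the preimage \<open>Z\<close> at a level \<open>n \<ge> m\<close> is the preimage of \<open>S\<close> under the composite bonding
  map, hence connected. If \<open>Z\<close> had a separation \<open>A \<union> B\<close>, its projections would therefore be joined
  by an edge at every such level (a common vertex counts, because of the loops), and by compactness
  some point of \<open>A\<close> would be joined to some point of \<open>B\<close>.\<close>

lemma projection_monotone:
  assumes m: "1 \<le> m" and S: "graph_connected (discrete_topology (V m)) (E m) S"
  shows "graph_connected X \<E> {x \<in> L. x m \<in> S}"
proof (rule ccontr)
  let ?Z = "{x \<in> L. x m \<in> S}"
  have SV: "S \<subseteq> V m"
    using S by (simp add: graph_connected_def)
  have level: "graph_connected (discrete_topology (V n)) (E n) ((\<lambda>x. x n) ` ?Z)" if "m \<le> n" for n
    using that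
  proof (induction n rule: dec_induct)
    case base
    have "(\<lambda>x. x m) ` ?Z = S"
      using SV vert_through[OF m] by (auto simp: image_iff) (metis subsetD)
    then show ?case
      using S by simp
  next
    case (step n)
    have n: "1 \<le> n"
      using m step by simp
    have "v \<in> (\<lambda>x. x (Suc n)) ` ?Z \<longleftrightarrow> v \<in> V (Suc n) \<and> f (Suc n) v \<in> (\<lambda>x. x n) ` ?Z" for v
    proof
      assume "v \<in> (\<lambda>x. x (Suc n)) ` ?Z"
      then obtain x where "x \<in> ?Z" "v = x (Suc n)"
        by blast
      then show "v \<in> V (Suc n) \<and> f (Suc n) v \<in> (\<lambda>x. x n) ` ?Z"
        using vert_mem[of x "Suc n"] vert_bonding[of x n] n by auto
    next
      assume v: "v \<in> V (Suc n) \<and> f (Suc n) v \<in> (\<lambda>x. x n) ` ?Z"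
      then obtain x where x: "x \<in> L" "x m \<in> S" "f (Suc n) v = x n"
        by blast
      obtain y where y: "y \<in> L" "y (Suc n) = v"
        using vert_through[of "Suc n" v] v by auto
      have "y n = x n"
        using vert_bonding[of y n] x y n by simp
      then have "y m = x m"
        using vert_eq_below x y m step by blast
      then show "v \<in> (\<lambda>x. x (Suc n)) ` ?Z"
        using x y by auto
    qed
    then have "(\<lambda>x. x (Suc n)) ` ?Z = {v \<in> V (Suc n). f (Suc n) v \<in> (\<lambda>x. x n) ` ?Z}"
      by blast
    then show ?case
      using bonding_monotone[OF n step.IH] by simp
  qed
  have ZX: "?Z \<subseteq> topspace X"
    by (auto simp: topspace_limit)
  assume "\<not> graph_connected X \<E> ?Z"
  then have "graph_disconnected X \<E> ?Z"
    using ZX by (simp add: graph_connected_def)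
  then obtain A B where AB: "?Z = A \<union> B" "A \<inter> B = {}" "A \<noteq> {}" "B \<noteq> {}"
    and cl: "closedin (subtopology X ?Z) A" "closedin (subtopology X ?Z) B"
    and no: "\<not> (\<exists>a\<in>A. \<exists>b\<in>B. (a, b) \<in> \<E> \<or> (b, a) \<in> \<E>)"
    unfolding graph_disconnected_def by blast
  have AL: "A \<subseteq> L" "B \<subseteq> L"
    using AB(1) by blast+
  have clAB: "closedin X A" "closedin X B"
    using cl clopen_cylinder(2)[OF m] closedin_trans_full by blast+
  have close: "\<exists>a\<in>A. \<exists>b\<in>B. (a n, b n) \<in> E n" if n: "m \<le> n" for n
  proof (rule ccontr)
    assume far: "\<not> (\<exists>a\<in>A. \<exists>b\<in>B. (a n, b n) \<in> E n)"
    have n1: "1 \<le> n"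
      using m n by simp
    have sub: "(\<lambda>x. x n) ` ?Z \<subseteq> V n"
      using vert_mem n1 by blast
    have "graph_disconnected (discrete_topology (V n)) (E n) ((\<lambda>x. x n) ` ?Z)"
      unfolding graph_disconnected_discrete[OF sub]
    proof (intro exI conjI)
      show "(\<lambda>x. x n) ` ?Z = (\<lambda>x. x n) ` A \<union> (\<lambda>x. x n) ` B"
        unfolding AB(1) by (rule image_Un)
      have "(a n, b n) \<in> E n" if "a \<in> A" "a n = b n" for a b
        using is_graph[OF n1] vert_mem[of a n] AL(1) that n1
        by (auto simp: is_graph_def refl_on_def)
      then show "(\<lambda>x. x n) ` A \<inter> (\<lambda>x. x n) ` B = {}"
        using far by blast
      show "\<not> (\<exists>a\<in>(\<lambda>x. x n) ` A. \<exists>b\<in>(\<lambda>x. x n) ` B. (a, b) \<in> E n \<or> (b, a) \<in> E n)"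
        using far is_graph[OF n1] by (auto simp: is_graph_def dest: symD)
    qed (use AB(3,4) in auto)
    then show False
      using level[OF n] by (simp add: graph_connected_def)
  qed
  obtain a b where "(a, b) \<in> A \<times> B" "a \<in> L" "b \<in> L" "\<And>n. 1 \<le> n \<Longrightarrow> (a n, b n) \<in> E n"
  proof (rule closed_relation_limit)
    show "closedin (prod_topology X X) (A \<times> B)"
      using clAB by (simp add: closedin_prod_Times_iff)
    show "\<exists>(x, y)\<in>A \<times> B. x \<in> L \<and> y \<in> L \<and> (x n, y n) \<in> E n" if n: "1 \<le> n" for n
    proof -
      obtain a b where "a \<in> A" "b \<in> B" "(a (max m n), b (max m n)) \<in> E (max m n)"
        using close[of "max m n"] by auto
      then show ?thesis
        using edge_below[of a b n "max m n"] AL n by (intro bexI[of _ "(a, b)"]) auto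
    qed
  qed (use edge_below in blast)+
  then show False
    using no by (auto simp: inv_limit_edges_def)
qed

lemma limit_connected: "graph_connected X \<E> L"
proof -
  have "{x \<in> L. x 1 \<in> V 1} = L"
    using vert_mem by auto
  then show ?thesis
    using projection_monotone[OF order_refl first_connected] by simp
qed

lemma projection_connected:
  assumes "1 \<le> n" "graph_connected X \<E> K"
  shows "graph_connected (discrete_topology (V n)) (E n) ((\<lambda>x. x n) ` K)"
  by (rule graph_connected_image[OF assms(2) continuous_projection[OF assms(1)]])
    (use assms(1) in \<open>auto simp: inv_limit_edges_def\<close>)

subsection \<open>The Kelley property\<close>

text \<open>For \<open>n > 0\<close> this is \<open>\<pi>\<^sub>n\<^sup>-\<^sup>1 (\<pi>\<^sub>n K)\<close>. There is no level \<open>0\<close>; taking the whole limit there covers the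
  points that share no coordinate with a given point of \<open>K\<close>.\<close>

definition thicken :: "nat \<Rightarrow> (nat \<Rightarrow> 'a) set \<Rightarrow> (nat \<Rightarrow> 'a) set" where
  "thicken n K = (if n = 0 then L else {x \<in> L. x n \<in> (\<lambda>y. y n) ` K})"

lemma thicken_connected:
  assumes "graph_connected X \<E> K"
  shows "graph_connected X \<E> (thicken n K)"
proof (cases "n = 0")
  case False
  then have "graph_connected X \<E> {x \<in> L. x n \<in> (\<lambda>y. y n) ` K}"
    using projection_monotone projection_connected assms by simp
  then show ?thesis
    using False by (simp add: thicken_def)
qed (simp add: thicken_def limit_connected)

lemma thicken_closed: "closedin X (thicken n K)"
  using clopen_cylinder(2) closedin_topspace[of X] by (simp add: thicken_def topspace_limit)

lemma thicken_antimono: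
  assumes "K \<subseteq> L" "1 \<le> m" "m \<le> n"
  shows "thicken n K \<subseteq> thicken m K"
proof
  fix x assume "x \<in> thicken n K"
  then obtain y where "x \<in> L" "y \<in> K" "x n = y n"
    using assms by (auto simp: thicken_def)
  then have "x m = y m"
    using assms vert_eq_below by blast
  then show "x \<in> thicken m K"
    using assms(2) \<open>x \<in> L\<close> \<open>y \<in> K\<close> by (auto simp: thicken_def)
qed

lemma subset_thicken: "K \<subseteq> L \<Longrightarrow> K \<subseteq> thicken n K"
  by (auto simp: thicken_def)

text \<open>Otherwise the closed set of pairs at distance at least \<open>e\<close> would contain pairs agreeing up to
  arbitrarily high levels, and by compactness a pair that agrees at every level.\<close>

lemma cylinders_uniformly_small:
  assumes d: "Metric_space L d" "Metric_space.mtopology L d = X" and e: "0 < e"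
  obtains n where "1 \<le> n" "\<And>x y. x \<in> L \<Longrightarrow> y \<in> L \<Longrightarrow> x n = y n \<Longrightarrow> d x y < e"
proof (rule ccontr)
  note uniform = that
  assume neg: "\<not> thesis"
  interpret Metric_space L d
    by (rule d)
  let ?C = "{p \<in> topspace (prod_topology X X). (\<lambda>(x, y). d x y) p \<in> {e..}}"
  have "continuous_map (prod_topology X X) euclideanreal (\<lambda>(x, y). d x y)"
    using continuous_map_metric[of "metric (L, d)"] d(2) by simp
  then have C: "closedin (prod_topology X X) ?C"
    by (rule closedin_continuous_map_preimage) simp
  obtain x y where xy: "(x, y) \<in> ?C" "x \<in> L" "y \<in> L" "\<And>n. 1 \<le> n \<Longrightarrow> (x n, y n) \<in> Id"
  proof (rule closed_relation_limit[OF C])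
    show "\<exists>(x, y)\<in>?C. x \<in> L \<and> y \<in> L \<and> (x n, y n) \<in> Id" if n: "1 \<le> n" for n
    proof -
      obtain x y where "x \<in> L" "y \<in> L" "x n = y n" "\<not> d x y < e"
        using neg uniform[OF n] by blast
      then show ?thesis
        by (intro bexI[of _ "(x, y)"]) (auto simp: topspace_limit)
    qed
  qed (use vert_eq_below in \<open>auto simp del: One_nat_def\<close>)
  then have "x = y"
    by (intro verts_eqI) auto
  then show False
    using xy e by simp
qed

text \<open>Since \<open>K \<subseteq> H\<close>, one of the two suprema in the Hausdorff distance vanishes; in the other, each
  point of \<open>H\<close> has a point of \<open>K\<close> in its cylinder of level \<open>n\<close>.\<close>

lemma hausdorff_metric_thicken_le:
  assumes d: "Metric_space L d" and K: "K \<subseteq> L" "K \<noteq> {}" and n: "1 \<le> n"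
    and small: "\<And>x y. x \<in> L \<Longrightarrow> y \<in> L \<Longrightarrow> x n = y n \<Longrightarrow> d x y \<le> e"
    and H: "K \<subseteq> H" "H \<subseteq> thicken n K"
  shows "\<bar>hausdorff_metric d H K\<bar> \<le> e"
proof -
  interpret Metric_space L d
    by (rule d)
  have HL: "H \<subseteq> L"
    using H n by (auto simp: thicken_def)
  have bdd: "bdd_below (d x ` S)" "bdd_below ((\<lambda>z. d z x) ` S)" for x S
    by (rule bdd_belowI[of _ 0]; auto)+
  have nonneg: "0 \<le> (INF b\<in>K. d a b)" for a
    using K by (intro cINF_greatest) auto
  have le: "(INF b\<in>K. d a b) \<le> e" if a: "a \<in> H" for a
  proof -
    obtain b where "b \<in> K" "a n = b n"
      using a H n by (auto simp: thicken_def)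
    then show ?thesis
      using small[of a b] a HL K cINF_lower2[OF bdd(1)] by blast
  qed
  have zero: "(INF a\<in>H. d a b) = 0" if b: "b \<in> K" for b
  proof (rule antisym)
    show "(INF a\<in>H. d a b) \<le> 0"
      using b H(1) K by (intro cINF_lower2[OF bdd(2), of b]) auto
    show "0 \<le> (INF a\<in>H. d a b)"
      using K H(1) by (intro cINF_greatest) auto
  qed
  have ne: "H \<noteq> {}"
    using K H by blast
  then obtain h where h: "h \<in> H"
    by blast
  have "(SUP a\<in>H. INF b\<in>K. d a b) \<le> e"
    using le ne by (intro cSUP_least)
  moreover have "0 \<le> (SUP a\<in>H. INF b\<in>K. d a b)"
    by (rule cSUP_upper2[OF bdd_aboveI2[OF le] h nonneg])
  moreover have "(SUP b\<in>K. INF a\<in>H. d a b) = 0"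
    using zero K by simp
  ultimately show ?thesis
    by (simp add: hausdorff_metric_def)
qed

lemma kelley_limit: "kelley X \<E>"
  unfolding kelley_def
proof (intro conjI allI impI)
  show "topological_graph X \<E>"
    by (rule topological_graph_limit)
  show "graph_connected X \<E> (topspace X)"
    using limit_connected by (simp add: topspace_limit)
  fix d K p ps
  assume "Metric_space (topspace X) d \<and> Metric_space.mtopology (topspace X) d = X"
  then have d: "Metric_space L d" "Metric_space.mtopology L d = X"
    by (simp_all add: topspace_limit)
  assume "closedin X K \<and> graph_connected X \<E> K \<and> p \<in> K \<and> (\<forall>n. ps n \<in> topspace X) \<and>
    limitin X ps p sequentially"
  then have K: "graph_connected X \<E> K" "K \<subseteq> L" "p \<in> K" and ps: "\<And>n. ps n \<in> L"
    and lim: "limitin X ps p sequentially"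
    using closedin_subset[of X K] by (auto simp: topspace_limit)
  \<comment> \<open>level \<open>0\<close> is included so that the maximum always exists; it yields the whole limit\<close>
  define agree where "agree n = {m. m \<le> n \<and> (m = 0 \<or> ps n m = p m)}" for n
  define l where "l n = Max (agree n)" for n
  have fin: "finite (agree n)" "0 \<in> agree n" for n
    by (auto simp: agree_def)
  then have l: "l n \<in> agree n" for n
    unfolding l_def by (intro Max_in) auto
  have mem: "ps n \<in> thicken (l n) K" for n
    using l[of n] ps K(3) by (auto simp: agree_def thicken_def)
  have l_ge: "\<forall>\<^sub>F n in sequentially. m \<le> l n" if m: "1 \<le> m" for m
  proof -
    have "p \<in> {x \<in> L. x m \<in> {p m}}"
      using K by auto
    then have "\<forall>\<^sub>F n in sequentially. ps n \<in> {x \<in> L. x m \<in> {p m}}"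
      using lim clopen_cylinder(1)[OF m] unfolding limitin_def by blast
    then show ?thesis
      using eventually_ge_at_top[of m]
    proof eventually_elim
      case (elim n)
      then have "m \<in> agree n"
        by (simp add: agree_def)
      then show ?case
        unfolding l_def using fin by (intro Max_ge)
    qed
  qed
  show "\<exists>Ks. (\<forall>n. closedin X (Ks n) \<and> graph_connected X \<E> (Ks n) \<and> ps n \<in> Ks n) \<and>
      (\<lambda>n. hausdorff_metric d (Ks n) K) \<longlonglongrightarrow> 0"
  proof (intro exI conjI allI)
    show "closedin X (thicken (l n) K)" "graph_connected X \<E> (thicken (l n) K)"
      "ps n \<in> thicken (l n) K" for n
      using thicken_closed thicken_connected[OF K(1)] mem by auto
    show "(\<lambda>n. hausdorff_metric d (thicken (l n) K) K) \<longlonglongrightarrow> 0"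
      unfolding tendsto_iff
    proof (intro allI impI)
      fix e :: real assume e: "0 < e"
      then obtain m where m: "1 \<le> m"
        "\<And>x y. x \<in> L \<Longrightarrow> y \<in> L \<Longrightarrow> x m = y m \<Longrightarrow> d x y < e / 2"
        using cylinders_uniformly_small[OF d, of "e / 2"] by (metis half_gt_zero)
      have "dist (hausdorff_metric d (thicken (l n) K) K) 0 < e" if "m \<le> l n" for n
      proof -
        have "\<bar>hausdorff_metric d (thicken (l n) K) K\<bar> \<le> e / 2"
        proof (rule hausdorff_metric_thicken_le[OF d(1) K(2) _ m(1)])
          show "thicken (l n) K \<subseteq> thicken m K"
            using thicken_antimono[OF K(2) m(1) that] .
        qed (use K m(2) subset_thicken in \<open>auto intro: less_imp_le\<close>)
        then show ?thesis
          using e by (simp add: dist_real_def)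
      qed
      then show "\<forall>\<^sub>F n in sequentially. dist (hausdorff_metric d (thicken (l n) K) K) 0 < e"
        using l_ge[OF m(1)] by (rule eventually_mono[rotated])
    qed
  qed
qed

end

section \<open>Deleting the first peak\<close>

theorem mainTheorem3:
  shows "(\<forall>n\<ge>2.
            poset_epi (dyck n) (ascent_order n) (dyck (n - 1)) (ascent_order (n - 1))
              delete_first_peak \<and>
            graph_epi (dyck n) (hasse_edges (dyck n) (ascent_order n))
              (dyck (n - 1)) (hasse_edges (dyck (n - 1)) (ascent_order (n - 1)))
              delete_first_peak \<and>
            monotone_epi
              (discrete_topology (dyck n)) (hasse_edges (dyck n) (ascent_order n))
              (discrete_topology (dyck (n - 1)))
              (hasse_edges (dyck (n - 1)) (ascent_order (n - 1)))
              delete_first_peak)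
       \<and> kelley
           (inv_limit_topology dyck (\<lambda>n. delete_first_peak))
           (inv_limit_edges dyck (\<lambda>n. hasse_edges (dyck n) (ascent_order n))
              (\<lambda>n. delete_first_peak))"
proof -
  let ?E = "\<lambda>n. hasse_edges (dyck n) (ascent_order n)"
  interpret monotone_system dyck ?E "\<lambda>n. delete_first_peak"
  proof
    show "graph_connected (discrete_topology (dyck 1)) (?E 1) (dyck 1)"
    proof (rule graph_connected_star)
      show "[Up, Down] \<in> dyck 1"
        unfolding dyck_1 by simp
      show "(P, [Up, Down]) \<in> ?E 1" if "P \<in> dyck 1" for P
        using that unfolding hasse_edges_dyck by (simp add: dyck_1 del: One_nat_def)
    qed simp
  qed (use finite_dyck monotone_epi_delete_first_peak in auto)
  have "poset_epi (dyck n) (ascent_order n) (dyck (n - 1)) (ascent_order (n - 1))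
        delete_first_peak \<and>
      graph_epi (dyck n) (?E n) (dyck (n - 1)) (?E (n - 1)) delete_first_peak \<and>
      monotone_epi (discrete_topology (dyck n)) (?E n) (discrete_topology (dyck (n - 1)))
        (?E (n - 1)) delete_first_peak" if "2 \<le> n" for n
  proof -
    obtain m where m: "n = Suc m" "1 \<le> m"
      using \<open>2 \<le> n\<close> by (cases n) auto
    show ?thesis
      using poset_epi_delete_first_peak[of m] graph_epi_delete_first_peak[of m]
        monotone_epi_delete_first_peak[OF m(2)] by (simp add: m(1))
  qed
  then show ?thesis
    using kelley_limit by blast
qed

end
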